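(* For every $\alpha>0$ there exists $\beta=\beta(\alpha)>0$ such that every set $A$ of $n$ points in $\mathbb{R}^3$ in general position satisfying $\Delta(A)\le \alpha n^{1/3}$ contains a subset of at least $\beta n^{1/2}$ points in convex position.
   Context: A finite set of points in $\mathbb{R}^3$ is in general position if any $4$ or fewer of its points are affinely independent, and in convex position if no point lies in the convex hull of the others. For a finite set $A\subset\mathbb{R}^d$ with at least two points, the spread $\Delta(A)$ is the ratio of the maximum pairwise Euclidean distance to the minimum pairwise Euclidean distance among points of $A$. *)

theory Defs
  imports "HOL-Analysis.Analysis"
begin

definition general_position :: "(real ^ 3) set \<Rightarrow> bool" where
  "general_position A \<longleftrightarrow>
     finite A \<and> (\<forall>B. B \<subseteq> A \<and> card B \<le> 4 \<longrightarrow> \<not> affine_dependent B)"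

definition convex_position :: "'a::real_vector set \<Rightarrow> bool" where
  "convex_position A \<longleftrightarrow> finite A \<and> (\<forall>x\<in>A. x \<notin> convex hull (A - {x}))"

definition pairwise_distances :: "'a::metric_space set \<Rightarrow> real set" where
  "pairwise_distances A = {dist x y |x y. x \<in> A \<and> y \<in> A \<and> x \<noteq> y}"

text \<open>Meaningful only for finite sets with at least two points.\<close>

definition spread :: "'a::euclidean_space set \<Rightarrow> real" where
  "spread A = Max (pairwise_distances A) / Min (pairwise_distances A)"

end

theory Submission
  imports Defs
begin

text \<open>
  Normalise the minimum distance of \<open>A\<close> to 1 and let \<open>s\<^sup>4\<close> bound its diameter, so that
  \<open>s\<^sup>1\<^sup>2\<close> is of order \<open>n\<close>.  After the volume-preserving change of coordinates
  \<open>(x / s, y / s, s\<^sup>2 z)\<close>, consider the convex paraboloid \<open>z \<ge> x\<^sup>2 + y\<^sup>2\<close> and its pairwise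
  disjoint caps of constant volume around the points \<open>(3i, 3j)\<close> with \<open>i, j < N\<close>, where \<open>N\<close> is of
  order \<open>s\<^sup>3\<close>.  One point from each cap gives a set in convex position, so it suffices to find a
  translate of the paraboloid for which a positive fraction of the \<open>N\<^sup>2\<close> caps meets \<open>A\<close>.
  Averaging over the \<open>O(s\<^sup>1\<^sup>2)\<close> relevant integer translations does this: a cap contains a
  constant number of points on average, and the second moment of that number is also bounded on
  average over the caps, because the caps are thin slabs in different directions and a pair of
  points at horizontal distance \<open>m\<close> fits into only \<open>O(N s / m)\<close> of them.
\<close>

text \<open>The integer translation that puts \<open>p\<close> into the cap at \<open>(3i, 3j)\<close>: in the coordinates above,
  it moves \<open>p\<close> over the unit square with lower corner \<open>(3i, 3j)\<close>, and the third component makes the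
  height over the tangent plane at that corner lie in \<open>[0, 1)\<close> (the paraboloid being lowered by 2,
  which bounds its height over the tangent plane on the unit square).\<close>

definition cap_shift :: "real \<Rightarrow> nat \<times> nat \<Rightarrow> real ^ 3 \<Rightarrow> int \<times> int \<times> int" where
  "cap_shift s = (\<lambda>(i, j) p.
     (\<lfloor>p$1 / s\<rfloor> - 3 * int i, \<lfloor>p$2 / s\<rfloor> - 3 * int j,
      \<lfloor>s\<^sup>2 * p$3 - 6 * (real i * frac (p$1 / s) + real j * frac (p$2 / s))\<rfloor>
        - 9 * ((int i)\<^sup>2 + (int j)\<^sup>2)))"

section \<open>Convex position, and tangent planes that separate the caps\<close>

lemma convex_position_singleton [simp]: "convex_position {x}"
  by (simp add: convex_position_def)

text \<open>Carries the subset found in a normalised copy of \<open>A\<close> back to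
  \<open>A\<close>: an injective affine map commutes with convex hulls.\<close>

lemma convex_position_affinity:
  fixes B :: "'a::real_vector set"
  assumes "c \<noteq> 0" "convex_position ((\<lambda>x. a + c *\<^sub>R x) ` B)"
  shows "convex_position B"
proof -
  let ?g = "\<lambda>x. a + c *\<^sub>R x"
  have inj: "inj ?g"
    using \<open>c \<noteq> 0\<close> by (auto simp: inj_on_def)
  have "finite B"
    using assms(2) inj by (metis convex_position_def finite_imageD inj_on_subset subset_UNIV)
  moreover have "x \<notin> convex hull (B - {x})" if "x \<in> B" for x
  proof
    assume "x \<in> convex hull (B - {x})"
    then have "?g x \<in> convex hull (?g ` (B - {x}))"
      unfolding convex_hull_affinity by (rule imageI)
    also have "?g ` (B - {x}) = ?g ` B - {?g x}"
      using inj by (auto simp: inj_on_def)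
    finally show False
      using assms(2) that by (auto simp: convex_position_def)
  qed
  ultimately show ?thesis
    by (simp add: convex_position_def)
qed

text \<open>The points other than \<open>x\<close> lie in an open half-space that misses
  \<open>x\<close>, hence so does their hull. The functional may depend on \<open>x\<close>; for a
  point of a cap it will be the normal of the tangent plane there.\<close>

lemma convex_position_if_strict_minimizers:
  fixes B :: "'a::real_inner set"
  assumes "finite B"
    and "\<And>x. x \<in> B \<Longrightarrow> \<exists>c. \<forall>y\<in>B - {x}. c \<bullet> x < c \<bullet> y"
  shows "convex_position B"
  unfolding convex_position_def
proof (intro conjI ballI)
  fix x assume "x \<in> B"
  then obtain c where "\<forall>y\<in>B - {x}. c \<bullet> x < c \<bullet> y"
    using assms(2) by blast
  then have "convex hull (B - {x}) \<subseteq> {y. c \<bullet> y > c \<bullet> x}"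
    by (intro hull_minimal convex_halfspace_gt) auto
  then show "x \<notin> convex hull (B - {x})"
    by auto
qed fact

text \<open>Both sides are, up to a common constant, heights over the tangent plane of the paraboloid at
  \<open>(3i, 3j)\<close>.\<close>

lemma cap_shift_separates:
  assumes "s > 0" "cap_shift s (i, j) p = cap_shift s (k, l) q" "(i, j) \<noteq> (k, l)"
  shows "s\<^sup>2 * p$3 - 6 * real i * (p$1 / s) - 6 * real j * (p$2 / s)
       < s\<^sup>2 * q$3 - 6 * real i * (q$1 / s) - 6 * real j * (q$2 / s)"
proof -
  define x y z where "x = p$1 / s" and "y = p$2 / s" and "z = s\<^sup>2 * p$3"
  define x' y' z' where "x' = q$1 / s" and "y' = q$2 / s" and "z' = s\<^sup>2 * q$3"
  define a b c d where "a = real i" and "b = real j" and "c = real k" and "d = real l"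
  obtain t1 t2 t3 :: real where
    t: "t1 = of_int (fst (cap_shift s (i, j) p))"
       "t2 = of_int (fst (snd (cap_shift s (i, j) p)))"
       "t3 = of_int (snd (snd (cap_shift s (i, j) p)))" by blast
  have x: "x = t1 + 3 * a + frac x" and y: "y = t2 + 3 * b + frac y"
    unfolding t cap_shift_def by (simp_all add: x_def y_def a_def b_def frac_def)
  have x': "x' = t1 + 3 * c + frac x'" and y': "y' = t2 + 3 * d + frac y'"
    unfolding t assms(2) unfolding cap_shift_def
    by (simp_all add: x'_def y'_def c_def d_def frac_def)
  have z: "z - 6 * (a * frac x + b * frac y) < t3 + 9 * (a\<^sup>2 + b\<^sup>2) + 1"
    unfolding t cap_shift_def
    by (simp add: x_def y_def z_def a_def b_def)
  have z': "z' - 6 * (c * frac x' + d * frac y') \<ge> t3 + 9 * (c\<^sup>2 + d\<^sup>2)"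
    unfolding t assms(2) unfolding cap_shift_def
    by (simp add: x'_def y'_def z'_def c_def d_def)
  define f g where "f = frac x'" and "g = frac y'"
  have fg: "0 \<le> f" "f \<le> 1" "0 \<le> g" "g \<le> 1"
    by (simp_all add: f_def g_def frac_lt_1 less_imp_le)
  have sep: "4 \<le> (3 * n + h)\<^sup>2" if "n \<ge> 1 \<or> n \<le> -1" "0 \<le> h" "h \<le> 1" for n h :: real
  proof -
    have "2 \<le> \<bar>3 * n + h\<bar>" using that by auto
    then have "2\<^sup>2 \<le> \<bar>3 * n + h\<bar>\<^sup>2" by (rule power_mono) simp
    then show ?thesis by simp
  qed
  have "c - a \<ge> 1 \<or> c - a \<le> -1 \<or> d - b \<ge> 1 \<or> d - b \<le> -1"
    using assms(3) by (auto simp: a_def b_def c_def d_def)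
  then have far: "(3 * (c - a) + f)\<^sup>2 + (3 * (d - b) + g)\<^sup>2 \<ge> 4"
    using sep[of "c - a" f] sep[of "d - b" g] fg
      zero_le_power2[of "3 * (c - a) + f"] zero_le_power2[of "3 * (d - b) + g"] by linarith
  have "f\<^sup>2 \<le> 1" "g\<^sup>2 \<le> 1"
    using fg by (auto simp: power2_eq_square mult_le_one)
  have "z - 6 * a * x - 6 * b * y < t3 + 1 - 6 * a * t1 - 6 * b * t2 - 9 * a\<^sup>2 - 9 * b\<^sup>2"
    using z by (subst x, subst y) (simp add: algebra_simps power2_eq_square)
  \<comment> \<open>Completing squares, right side minus left side is the left side of
    \<open>far\<close> minus \<open>f\<^sup>2 + g\<^sup>2 + 1\<close>, hence at least 1. The 4 in
    \<open>far\<close> comes from the spacing 3 of the base points of unit squares.\<close>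
  also have "\<dots> \<le> t3 + 9 * (c\<^sup>2 + d\<^sup>2) + 6 * (c * f + d * g)
      - 6 * a * (t1 + 3 * c + f) - 6 * b * (t2 + 3 * d + g)"
    using far \<open>f\<^sup>2 \<le> 1\<close> \<open>g\<^sup>2 \<le> 1\<close> by (simp add: algebra_simps power2_eq_square)
  also have "\<dots> \<le> z' - 6 * a * x' - 6 * b * y'"
    using z' x' y' unfolding f_def g_def by simp
  finally show ?thesis
    by (simp add: x_def y_def z_def x'_def y'_def z'_def a_def b_def)
qed

section \<open>The slab condition for two points in one cap, and counting tools\<close>

lemma cap_shift_collision:
  assumes "s > 0" "cap_shift s (i, j) p = cap_shift s (i, j) q"
  shows "\<bar>q$1 - p$1\<bar> < s" "\<bar>q$2 - p$2\<bar> < s"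
    "\<bar>s\<^sup>2 * (q$3 - p$3) - 6 * (real i * ((q$1 - p$1) / s) + real j * ((q$2 - p$2) / s))\<bar> < 1"
proof -
  have f: "\<lfloor>p$1 / s\<rfloor> = \<lfloor>q$1 / s\<rfloor>" "\<lfloor>p$2 / s\<rfloor> = \<lfloor>q$2 / s\<rfloor>"
    "\<lfloor>s\<^sup>2 * p$3 - 6 * (real i * frac (p$1 / s) + real j * frac (p$2 / s))\<rfloor>
      = \<lfloor>s\<^sup>2 * q$3 - 6 * (real i * frac (q$1 / s) + real j * frac (q$2 / s))\<rfloor>"
    using assms(2) by (simp_all add: cap_shift_def)
  have *: "\<bar>b - a\<bar> < 1" if "\<lfloor>a\<rfloor> = \<lfloor>b\<rfloor>" for a b :: real
    using that by linarith
  show "\<bar>q$1 - p$1\<bar> < s" "\<bar>q$2 - p$2\<bar> < s"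
    using *[OF f(1)] *[OF f(2)] \<open>s > 0\<close>
    by (simp_all add: diff_divide_distrib[symmetric] abs_divide)
  \<comment> \<open>Equal integer parts turn differences of fractional parts into true differences,
    so the third component yields a condition that is affine in \<open>(i, j)\<close> for a fixed
    pair of points.\<close>
  have d: "frac (q$1 / s) - frac (p$1 / s) = (q$1 - p$1) / s"
    "frac (q$2 / s) - frac (p$2 / s) = (q$2 - p$2) / s"
    using f by (simp_all add: frac_def diff_divide_distrib)
  show "\<bar>s\<^sup>2 * (q$3 - p$3) - 6 * (real i * ((q$1 - p$1) / s) + real j * ((q$2 - p$2) / s))\<bar> < 1"
    using *[OF f(3)] unfolding d[symmetric] by (simp add: algebra_simps)
qed

text \<open>A linearised Cauchy-Schwarz inequality: a fibre of size \<open>X\<close> contributes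
  \<open>2X/k - (X/k)\<^sup>2 \<le> 1\<close> to the left side. Being linear in the number of
  colliding pairs, the bound can be summed over all caps before that number is estimated.\<close>

lemma card_fibres_le_card_image:
  fixes f :: "'a \<Rightarrow> 'b" and k :: real
  assumes "finite A" "k > 0"
  shows "2 * real (card A) / k - (\<Sum>p\<in>A. real (card {q\<in>A. f q = f p})) / k\<^sup>2 \<le> card (f ` A)"
proof -
  let ?h = "\<lambda>p. 2 / k - real (card {q\<in>A. f q = f p}) / k\<^sup>2"
  have "2 * real (card A) / k - (\<Sum>p\<in>A. real (card {q\<in>A. f q = f p})) / k\<^sup>2 = sum ?h A"
    by (simp add: sum_subtractf sum_divide_distrib)
  also have "\<dots> = (\<Sum>y\<in>f ` A. sum ?h {x\<in>A. f x = y})"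
    using \<open>finite A\<close> by (rule sum.image_gen)
  also have "\<dots> \<le> (\<Sum>y\<in>f ` A. 1)"
  proof (rule sum_mono)
    fix y assume "y \<in> f ` A"
    define X where "X = real (card {x\<in>A. f x = y})"
    have "sum ?h {x\<in>A. f x = y} = (\<Sum>x\<in>{x\<in>A. f x = y}. 2 / k - X / k\<^sup>2)"
      by (rule sum.cong) (auto simp: X_def)
    also have "\<dots> = X * (2 / k - X / k\<^sup>2)"
      by (simp add: X_def)
    also have "\<dots> = 1 - (1 - X / k)\<^sup>2"
      using \<open>k > 0\<close> by (simp add: power2_eq_square field_simps)
    finally show "sum ?h {x\<in>A. f x = y} \<le> 1" by simp
  qed
  finally show ?thesis by simp
qed

lemma card_nat_le_if_diff_le:
  fixes I :: "nat set" and L :: real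
  assumes "finite I" "L \<ge> 0" "\<And>i j. i \<in> I \<Longrightarrow> j \<in> I \<Longrightarrow> real i - real j \<le> L"
  shows "real (card I) \<le> L + 1"
proof (cases "I = {}")
  case False
  have "card I \<le> card {Min I..Max I}"
    using \<open>finite I\<close> by (intro card_mono) auto
  then have "real (card I) \<le> real (Max I) - real (Min I) + 1"
    using Min_le[OF \<open>finite I\<close> Max_in[OF \<open>finite I\<close> False]] by (simp add: of_nat_diff)
  also have "\<dots> \<le> L + 1"
    using assms False by simp
  finally show ?thesis .
qed (use assms in auto)

lemma card_multiples_near_le:
  fixes c u :: real
  assumes "u \<noteq> 0"
  shows "real (card {i\<in>{..<N}. \<bar>c - real i * u\<bar> < 1}) \<le> 2 / \<bar>u\<bar> + 1"
proof (rule card_nat_le_if_diff_le)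
  fix i j assume "i \<in> {i\<in>{..<N}. \<bar>c - real i * u\<bar> < 1}" "j \<in> {i\<in>{..<N}. \<bar>c - real i * u\<bar> < 1}"
  then have "\<bar>(c - real j * u) - (c - real i * u)\<bar> \<le> 2" by auto
  then have "\<bar>real i - real j\<bar> * \<bar>u\<bar> \<le> 2" by (simp add: abs_mult[symmetric] algebra_simps)
  then have "\<bar>real i - real j\<bar> \<le> 2 / \<bar>u\<bar>" using assms by (simp add: field_simps)
  then show "real i - real j \<le> 2 / \<bar>u\<bar>" by linarith
qed auto

text \<open>For each of the \<open>N\<close> values of \<open>j\<close>, the admissible
  \<open>i\<close> lie in a window of length \<open>2 / \<bar>u\<bar>\<close>.\<close>

lemma card_lattice_strip_le_aux:
  fixes c u v :: real
  assumes "u \<noteq> 0"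
  shows "real (card {(i, j). i < N \<and> j < N \<and> \<bar>c - (real i * u + real j * v)\<bar> < 1})
    \<le> real N * (2 / \<bar>u\<bar> + 1)"
proof -
  let ?S = "{(i, j). i < N \<and> j < N \<and> \<bar>c - (real i * u + real j * v)\<bar> < 1}"
  have "?S = prod.swap ` (SIGMA j:{..<N}. {i\<in>{..<N}. \<bar>(c - real j * v) - real i * u\<bar> < 1})"
    by (auto simp: algebra_simps image_iff)
  then have "card ?S = card (SIGMA j:{..<N}. {i\<in>{..<N}. \<bar>(c - real j * v) - real i * u\<bar> < 1})"
    by (simp add: card_image)
  also have "\<dots> = (\<Sum>j<N. card {i\<in>{..<N}. \<bar>(c - real j * v) - real i * u\<bar> < 1})"
    by (rule card_SigmaI) auto
  finally have "real (card ?S) = (\<Sum>j<N. real (card {i\<in>{..<N}. \<bar>(c - real j * v) - real i * u\<bar> < 1}))"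
    by simp
  also have "\<dots> \<le> (\<Sum>j<N. 2 / \<bar>u\<bar> + 1)"
    by (intro sum_mono card_multiples_near_le assms)
  finally show ?thesis by simp
qed

text \<open>Slices along the coordinate with the larger coefficient. In the application the lattice
  points index caps, and the strip is the slab condition for a fixed pair of points.\<close>

lemma card_lattice_strip_le:
  fixes c u v :: real
  assumes "max \<bar>u\<bar> \<bar>v\<bar> > 0"
  shows "real (card {(i, j). i < N \<and> j < N \<and> \<bar>c - (real i * u + real j * v)\<bar> < 1})
    \<le> real N * (2 / max \<bar>u\<bar> \<bar>v\<bar> + 1)"
proof (cases "\<bar>u\<bar> \<ge> \<bar>v\<bar>")
  case True
  then show ?thesis using card_lattice_strip_le_aux[of u N c v] assms by auto
next
  case False
  have "{(i, j). i < N \<and> j < N \<and> \<bar>c - (real i * u + real j * v)\<bar> < 1}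
    = prod.swap ` {(i, j). i < N \<and> j < N \<and> \<bar>c - (real i * v + real j * u)\<bar> < 1}"
    by (auto simp: algebra_simps image_iff)
  then show ?thesis using False card_lattice_strip_le_aux[of v N c u] by (simp add: card_image)
qed


section \<open>The number of caps shared by pairs of points\<close>

lemma dist_power2_3:
  fixes p q :: "real ^ 3"
  shows "(dist p q)\<^sup>2 = (q$1 - p$1)\<^sup>2 + (q$2 - p$2)\<^sup>2 + (q$3 - p$3)\<^sup>2"
  unfolding dist_norm power2_norm_eq_inner
  by (simp add: inner_vec_def sum_3 power2_eq_square algebra_simps)

lemma card_int_interval_le:
  fixes a b :: int and r :: real
  assumes "of_int b - of_int a + 1 \<le> r" "0 \<le> r"
  shows "real (card {a..b}) \<le> r"
  using assms by (simp add: of_nat_nat)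

text \<open>As \<open>N \<le> s ^ 3 / 6\<close>, the slabs have slope at most 1 along each
  horizontal axis in the original coordinates, and the allowed vertical deviation is below
  \<open>1 / s\<^sup>2 \<le> 1/4\<close>. So separated points in one cap cannot be nearly above each
  other.\<close>

lemma cap_shift_collision_distance:
  assumes "s \<ge> 2" "real N \<le> s ^ 3 / 6" "i < N" "j < N"
    and "cap_shift s (i, j) p = cap_shift s (i, j) q" "dist p q \<ge> 1"
  shows "\<bar>q$3 - p$3\<bar> \<le> 1/4 + 2 * max \<bar>q$1 - p$1\<bar> \<bar>q$2 - p$2\<bar>"
    and "1/4 < max \<bar>q$1 - p$1\<bar> \<bar>q$2 - p$2\<bar>"
proof -
  define u v w where "u = q$1 - p$1" and "v = q$2 - p$2" and "w = q$3 - p$3"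
  define m where "m = max \<bar>u\<bar> \<bar>v\<bar>"
  have m: "0 \<le> m" "\<bar>u\<bar> \<le> m" "\<bar>v\<bar> \<le> m"
    by (auto simp: m_def)
  have s2: "4 \<le> s\<^sup>2"
    using power_mono[of 2 s 2] \<open>s \<ge> 2\<close> by simp
  have bnd: "6 * \<bar>real k * (x / s)\<bar> \<le> s\<^sup>2 * m" if "k < N" "\<bar>x\<bar> \<le> m" for k x
  proof -
    have "6 * \<bar>real k * (x / s)\<bar> = 6 * real k * (\<bar>x\<bar> / s)"
      using \<open>s \<ge> 2\<close> by (simp add: abs_mult)
    also have "\<dots> \<le> s ^ 3 * (m / s)"
      using that assms by (intro mult_mono divide_right_mono) auto
    also have "\<dots> = s\<^sup>2 * m"
      using \<open>s \<ge> 2\<close> by (simp add: power3_eq_cube power2_eq_square)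
    finally show ?thesis .
  qed
  have "\<bar>s\<^sup>2 * w - 6 * (real i * (u / s) + real j * (v / s))\<bar> < 1"
    using cap_shift_collision(3)[OF _ assms(5)] \<open>s \<ge> 2\<close> by (simp add: u_def v_def w_def)
  moreover have "\<bar>6 * (real i * (u / s) + real j * (v / s))\<bar> \<le> 2 * (s\<^sup>2 * m)"
  proof -
    have *: "\<bar>6 * (x + y)\<bar> \<le> 2 * c" if "6 * \<bar>x\<bar> \<le> c" "6 * \<bar>y\<bar> \<le> c" for x y c :: real
      using that unfolding distrib_left by linarith
    show ?thesis
      by (rule *[OF bnd[OF \<open>i < N\<close> m(2)] bnd[OF \<open>j < N\<close> m(3)]])
  qed
  moreover have "\<bar>x\<bar> \<le> 1 + c" if "\<bar>x - y\<bar> < 1" "\<bar>y\<bar> \<le> c" for x y c :: real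
    using that by linarith
  ultimately have "\<bar>s\<^sup>2 * w\<bar> \<le> 1 + 2 * (s\<^sup>2 * m)"
    by metis
  then have "s\<^sup>2 * \<bar>w\<bar> \<le> s\<^sup>2 * (1/4 + 2 * m)"
    using s2 by (simp add: abs_mult algebra_simps)
  then have w: "\<bar>w\<bar> \<le> 1/4 + 2 * m"
    by (rule mult_left_le_imp_le) (use s2 in linarith)
  then show "\<bar>q$3 - p$3\<bar> \<le> 1/4 + 2 * max \<bar>q$1 - p$1\<bar> \<bar>q$2 - p$2\<bar>"
    by (simp add: u_def v_def w_def m_def)
  show "1/4 < max \<bar>q$1 - p$1\<bar> \<bar>q$2 - p$2\<bar>"
  proof (rule ccontr)
    assume "\<not> ?thesis"
    then have "m \<le> 1/4" by (simp add: m_def u_def v_def)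
    \<comment> \<open>The squares add up to at most \<open>1/16 + 1/16 + 9/16 < 1\<close>.\<close>
    then have le: "\<bar>u\<bar> \<le> 1/4" "\<bar>v\<bar> \<le> 1/4" "\<bar>w\<bar> \<le> 3/4"
      using m w by linarith+
    have "u\<^sup>2 + v\<^sup>2 + w\<^sup>2 < 1"
      using le[THEN power_mono, of 2] by (simp add: power_divide)
    moreover have "1 \<le> (dist p q)\<^sup>2"
      using assms(6) by simp
    ultimately show False
      by (simp add: dist_power2_3 u_def v_def w_def)
  qed
qed

text \<open>For a fixed pair the slab condition is a lattice strip in \<open>(i, j)\<close> with
  larger coefficient \<open>6 * m / s\<close>, so pairs far apart horizontally share fewer
  caps.\<close>

lemma card_cap_shift_collision_le:
  assumes "s \<ge> 2" "max \<bar>q$1 - p$1\<bar> \<bar>q$2 - p$2\<bar> \<le> s" "0 < max \<bar>q$1 - p$1\<bar> \<bar>q$2 - p$2\<bar>"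
  shows "real (card {\<sigma> \<in> {..<N} \<times> {..<N}. cap_shift s \<sigma> p = cap_shift s \<sigma> q})
    \<le> 2 * real N * s / max \<bar>q$1 - p$1\<bar> \<bar>q$2 - p$2\<bar>"
proof -
  define u v w where "u = q$1 - p$1" and "v = q$2 - p$2" and "w = q$3 - p$3"
  define m where "m = max \<bar>u\<bar> \<bar>v\<bar>"
  have m: "0 < m" "m \<le> s"
    using assms by (auto simp: m_def u_def v_def)
  let ?S = "{(i, j). i < N \<and> j < N \<and> \<bar>s\<^sup>2 * w - (real i * (6 * u / s) + real j * (6 * v / s))\<bar> < 1}"
  have "{\<sigma> \<in> {..<N} \<times> {..<N}. cap_shift s \<sigma> p = cap_shift s \<sigma> q} \<subseteq> ?S"
  proof clarsimp
    fix i j assume "cap_shift s (i, j) p = cap_shift s (i, j) q"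
    from cap_shift_collision(3)[OF _ this] \<open>s \<ge> 2\<close>
    show "\<bar>s\<^sup>2 * w - (real i * (6 * u) / s + real j * (6 * v) / s)\<bar> < 1"
      by (simp add: u_def v_def w_def algebra_simps)
  qed
  moreover have "finite ?S"
    by (rule finite_subset[of _ "{..<N} \<times> {..<N}"]) auto
  ultimately have "real (card {\<sigma> \<in> {..<N} \<times> {..<N}. cap_shift s \<sigma> p = cap_shift s \<sigma> q}) \<le> card ?S"
    by (simp add: card_mono)
  also have mx: "max \<bar>6 * u / s\<bar> \<bar>6 * v / s\<bar> = 6 * m / s"
    using \<open>s \<ge> 2\<close> by (auto simp: m_def max_def abs_mult divide_simps)
  have "card ?S \<le> real N * (2 / (6 * m / s) + 1)"
    using card_lattice_strip_le[of "6 * u / s" "6 * v / s" N "s\<^sup>2 * w"] m \<open>s \<ge> 2\<close>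
    unfolding mx by simp
  \<comment> \<open>The summand 1 is absorbed because \<open>1 \<le> s / m\<close>.\<close>
  also have "\<dots> \<le> real N * (2 * s / m)"
    using m \<open>s \<ge> 2\<close> by (intro mult_left_mono) (auto simp: field_simps)
  finally show ?thesis
    by (simp add: m_def u_def v_def mult.assoc mult.left_commute)
qed

text \<open>Points at mutual distance at least 1 are told apart by the cells of a grid of side 1/2.
  A vertical column of that grid at horizontal distance about \<open>m\<close> from \<open>p\<close> contains \<open>O(m)\<close> points
  that can share a cap with \<open>p\<close>, and each of them does so for \<open>O(N s / m)\<close> caps; hence every
  column contributes \<open>O(N s)\<close>, however far away it is.\<close>

lemma sum_collisions_le:
  fixes A :: "(real ^ 3) set"
  assumes "s \<ge> 2" "real N \<le> s ^ 3 / 6" "finite A" "p \<in> A"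
    and sep: "\<And>x y. x \<in> A \<Longrightarrow> y \<in> A \<Longrightarrow> x \<noteq> y \<Longrightarrow> dist x y \<ge> 1"
  shows "(\<Sum>q\<in>A - {p}. real (card {\<sigma> \<in> {..<N} \<times> {..<N}. cap_shift s \<sigma> p = cap_shift s \<sigma> q}))
    \<le> 5760 * real N * s ^ 3"
proof -
  define g where "g q = real (card {\<sigma> \<in> {..<N} \<times> {..<N}. cap_shift s \<sigma> p = cap_shift s \<sigma> q})" for q
  define Q where "Q = {q \<in> A - {p}. g q \<noteq> 0}"
  define m where "m q = max \<bar>q$1 - p$1\<bar> \<bar>q$2 - p$2\<bar>" for q :: "real ^ 3"
  define M where "M = (\<lambda>(a :: int, b :: int). max \<bar>a\<bar> \<bar>b\<bar>)"
  \<comment> \<open>The grid cell of \<open>q\<close> relative to \<open>p\<close>, split into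
    column and level; \<open>M\<close> of the column is within 1 of \<open>2 * m q\<close>.\<close>
  define \<phi> where "\<phi> q = ((\<lfloor>2 * (q$1 - p$1)\<rfloor>, \<lfloor>2 * (q$2 - p$2)\<rfloor>), \<lfloor>2 * (q$3 - p$3)\<rfloor>)"
    for q :: "real ^ 3"
  \<comment> \<open>\<open>I\<close> bounds the column indices, as horizontal offsets are below
    \<open>s\<close>; \<open>Z c\<close> bounds the levels in column \<open>c\<close>, by the slope
    bound; \<open>G c\<close> bounds the number of caps that a point of \<open>Q\<close> there
    shares with \<open>p\<close>.\<close>
  define I where "I = {-\<lceil>2 * s\<rceil> - 1..\<lceil>2 * s\<rceil>}"
  define Z where "Z c = {-2 * (M c + 1) - 1..2 * (M c + 1)}" for c
  define G where "G c = 20 * real N * s / (real_of_int (M c) + 1)" for c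
  have M0: "M c \<ge> 0" for c
    by (auto simp: M_def split: prod.splits)
  have Q: "m q < s \<and> 1/4 < m q \<and> \<bar>q$3 - p$3\<bar> \<le> 1/4 + 2 * m q" if "q \<in> Q" for q
  proof -
    obtain i j where ij: "i < N" "j < N" "cap_shift s (i, j) p = cap_shift s (i, j) q"
    proof -
      have "{\<sigma> \<in> {..<N} \<times> {..<N}. cap_shift s \<sigma> p = cap_shift s \<sigma> q} \<noteq> {}"
        using \<open>q \<in> Q\<close> unfolding Q_def g_def by (metis (mono_tags, lifting) card.empty mem_Collect_eq of_nat_0)
      then show thesis using that by blast
    qed
    have "dist p q \<ge> 1"
      using that sep \<open>p \<in> A\<close> by (auto simp: Q_def)
    then show ?thesis
      using cap_shift_collision[OF _ ij(3)] \<open>s \<ge> 2\<close>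
        cap_shift_collision_distance[OF assms(1,2) ij \<open>dist p q \<ge> 1\<close>]
      by (auto simp: m_def)
  qed
  have Mm: "2 * m q \<le> M (fst (\<phi> q)) + 1 \<and> M (fst (\<phi> q)) \<le> 2 * m q + 1" for q
  proof -
    have *: "2 * \<bar>x\<bar> \<le> \<bar>real_of_int \<lfloor>2 * x\<rfloor>\<bar> + 1 \<and> \<bar>real_of_int \<lfloor>2 * x\<rfloor>\<bar> \<le> 2 * \<bar>x\<bar> + 1" for x :: real
      by linarith
    have **: "2 * max a b \<le> max c d + 1 \<and> max c d \<le> 2 * max a b + 1"
      if "2 * a \<le> c + 1 \<and> c \<le> 2 * a + 1" "2 * b \<le> d + 1 \<and> d \<le> 2 * b + 1" for a b c d :: real
      using that by (auto simp: max_def)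
    show ?thesis
      unfolding M_def \<phi>_def m_def fst_conv prod.case of_int_add of_int_1 of_int_max of_int_abs
      by (rule **[OF * *])
  qed
  \<comment> \<open>Points in one cell differ by at most 1/2 in each coordinate, so their squared
    distance is at most 3/4.\<close>
  have inj: "inj_on \<phi> Q"
  proof (rule inj_onI, rule ccontr)
    fix x y assume xy: "x \<in> Q" "y \<in> Q" "\<phi> x = \<phi> y" "x \<noteq> y"
    have *: "\<bar>b - a\<bar> \<le> 1/2" if "\<lfloor>2 * (a - c)\<rfloor> = \<lfloor>2 * (b - c)\<rfloor>" for a b c :: real
      using that unfolding right_diff_distrib by linarith
    have **: "(b - a)\<^sup>2 \<le> 1/4" if "\<lfloor>2 * (a - c)\<rfloor> = \<lfloor>2 * (b - c)\<rfloor>" for a b c :: real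
      using power_mono[OF *[OF that], of 2] by (simp add: power2_eq_square)
    have "(dist x y)\<^sup>2 < 1"
      using xy(3) **[of "x$1" "p$1" "y$1"] **[of "x$2" "p$2" "y$2"] **[of "x$3" "p$3" "y$3"]
      unfolding dist_power2_3 by (simp add: \<phi>_def)
    moreover have "dist x y \<ge> 1"
      using xy sep by (auto simp: Q_def)
    ultimately show False
      by (simp add: power_less_one_iff)
  qed
  have sub: "\<phi> ` Q \<subseteq> (SIGMA c:I \<times> I. Z c)"
  proof
    fix k assume "k \<in> \<phi> ` Q"
    then obtain q where q: "q \<in> Q" "k = \<phi> q" by blast
    have "\<bar>q$1 - p$1\<bar> < s" "\<bar>q$2 - p$2\<bar> < s"
      using Q[OF q(1)] by (auto simp: m_def)
    then have "fst (\<phi> q) \<in> I \<times> I"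
      unfolding I_def \<phi>_def by simp linarith
    moreover have "\<bar>q$3 - p$3\<bar> \<le> 1/4 + (M (fst (\<phi> q)) + 1)"
      using Q[OF q(1)] Mm[of q] by linarith
    then have "snd (\<phi> q) \<in> Z (fst (\<phi> q))"
      unfolding Z_def by (simp add: \<phi>_def) linarith
    ultimately show "k \<in> (SIGMA c:I \<times> I. Z c)"
      using q(2) by (simp add: mem_Sigma_iff prod.expand \<phi>_def)
  qed
  have gG: "g q \<le> G (fst (\<phi> q))" if "q \<in> Q" for q
  proof -
    have "g q \<le> 2 * real N * s / m q"
      using card_cap_shift_collision_le[of s q p N] Q[OF that] \<open>s \<ge> 2\<close> by (simp add: g_def m_def)
    \<comment> \<open>\<open>M + 1 \<le> 2m + 2 < 10m\<close>, the last because
      \<open>m > 1/4\<close>.\<close>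
    also have "\<dots> \<le> 2 * real N * s / ((M (fst (\<phi> q)) + 1) / 10)"
      using Q[OF that] Mm[of q] M0[of "fst (\<phi> q)"] \<open>s \<ge> 2\<close>
      by (intro divide_left_mono mult_pos_pos) auto
    finally show ?thesis by (simp add: G_def)
  qed
  have "sum g (A - {p}) = sum g Q"
    using \<open>finite A\<close> by (intro sum.mono_neutral_right) (auto simp: Q_def)
  also have "\<dots> \<le> (\<Sum>q\<in>Q. G (fst (\<phi> q)))"
    by (intro sum_mono gG)
  also have "\<dots> = (\<Sum>k\<in>\<phi> ` Q. G (fst k))"
    using inj by (simp add: sum.reindex)
  also have "\<dots> \<le> (\<Sum>k\<in>(SIGMA c:I \<times> I. Z c). G (fst k))"
    using sub M0 \<open>s \<ge> 2\<close>
    by (intro sum_mono2) (auto simp: I_def Z_def G_def intro!: divide_nonneg_nonneg add_nonneg_nonneg)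
  also have "\<dots> = (\<Sum>c\<in>I \<times> I. \<Sum>k\<in>Z c. G c)"
    by (subst sum.Sigma) (auto simp: I_def Z_def case_prod_beta)
  \<comment> \<open>A column has \<open>4(M + 1) + 2 \<le> 8(M + 1)\<close> levels; the factor
    \<open>M + 1\<close> cancels against \<open>G c\<close>, leaving
    \<open>8 * 20 = 160\<close>.\<close>
  also have "\<dots> \<le> (\<Sum>c\<in>I \<times> I. 160 * real N * s)"
  proof (rule sum_mono)
    fix c
    have "real (card (Z c)) \<le> 8 * (real_of_int (M c) + 1)"
      unfolding Z_def using M0[of c] by (intro card_int_interval_le) auto
    then have "real (card (Z c)) * G c \<le> 8 * (real_of_int (M c) + 1) * G c"
      using M0[of c] \<open>s \<ge> 2\<close> by (intro mult_right_mono) (auto simp: G_def)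
    also have "\<dots> = 160 * real N * s"
      using M0[of c] by (simp add: G_def add_nonneg_eq_0_iff nonzero_divide_eq_eq algebra_simps)
    finally show "(\<Sum>k\<in>Z c. G c) \<le> 160 * real N * s" by simp
  qed
  also have "\<dots> = real (card I) * real (card I) * (160 * real N * s)"
    by (simp add: card_cartesian_product)
  \<comment> \<open>\<open>I\<close> has at most \<open>4s + 4 \<le> 6s\<close> elements.\<close>
  also have "\<dots> \<le> (6 * s) * (6 * s) * (160 * real N * s)"
  proof -
    have "real (card I) \<le> 6 * s"
      unfolding I_def
    proof (rule card_int_interval_le)
      show "real_of_int \<lceil>2 * s\<rceil> - real_of_int (- \<lceil>2 * s\<rceil> - 1) + 1 \<le> 6 * s"
        using \<open>s \<ge> 2\<close> by simp linarith
    qed (use \<open>s \<ge> 2\<close> in auto)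
    then show ?thesis
      using \<open>s \<ge> 2\<close> by (intro mult_right_mono mult_mono) auto
  qed
  also have "\<dots> = 5760 * real N * s ^ 3"
    by (simp add: power3_eq_cube)
  finally show ?thesis
    by (simp add: g_def)
qed


section \<open>The range of the translations\<close>

text \<open>Scaling turns the bound \<open>s ^ 4\<close> into \<open>s ^ 3\<close> horizontally and
  \<open>s ^ 6\<close> vertically. Since \<open>N \<le> s ^ 3 / 6\<close>, the base points and the
  heights \<open>9(i\<^sup>2 + j\<^sup>2) \<le> s ^ 6 / 2\<close> have the same orders, so only
  O(s^12) translations occur.\<close>

lemma cap_shift_range:
  assumes "s \<ge> 2" "real N \<le> s ^ 3 / 6" "i < N" "j < N" "\<And>k. \<bar>p$k\<bar> \<le> s ^ 4"
  shows "cap_shift s (i, j) p \<in> {-3 * \<lceil>s ^ 3\<rceil>..\<lceil>s ^ 3\<rceil>} \<times> {-3 * \<lceil>s ^ 3\<rceil>..\<lceil>s ^ 3\<rceil>}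
    \<times> {-4 * \<lceil>s ^ 6\<rceil>..\<lceil>s ^ 6\<rceil>}"
proof -
  have s3: "8 \<le> s ^ 3"
    using power_mono[of 2 s 3] \<open>s \<ge> 2\<close> by simp
  have s6: "s ^ 6 = s ^ 3 * s ^ 3"
    by (simp flip: power_add)
  then have s36: "8 * s ^ 3 \<le> s ^ 6"
    using mult_right_mono[OF s3, of "s ^ 3"] s3 by linarith
  have horizontal: "\<lfloor>p$k / s\<rfloor> - 3 * int l \<in> {-3 * \<lceil>s ^ 3\<rceil>..\<lceil>s ^ 3\<rceil>}" if "l < N" for k l
  proof -
    have "\<bar>p$k / s\<bar> \<le> s ^ 4 / s"
      using assms(5)[of k] \<open>s \<ge> 2\<close> by (simp add: divide_right_mono)
    also have "\<dots> = s ^ 3"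
      using \<open>s \<ge> 2\<close> by (simp add: power_numeral_reduce)
    finally have x: "\<bar>p$k / s\<bar> \<le> s ^ 3" .
    have "6 * real l \<le> s ^ 3"
      using that assms(2) by linarith
    then show ?thesis
      unfolding atLeastAtMost_iff using x s3 by (intro conjI) linarith+
  qed
  define a b where "a = real i" and "b = real j"
  define f g where "f = frac (p$1 / s)" and "g = frac (p$2 / s)"
  have ab: "0 \<le> a" "a \<le> s ^ 3 / 6" "0 \<le> b" "b \<le> s ^ 3 / 6"
    using assms by (auto simp: a_def b_def)
  have fg: "0 \<le> f" "f \<le> 1" "0 \<le> g" "g \<le> 1"
    by (simp_all add: f_def g_def frac_lt_1 less_imp_le)
  have "\<bar>s\<^sup>2 * p$3\<bar> \<le> s\<^sup>2 * s ^ 4"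
    unfolding abs_mult using assms(5)[of 3] by (intro mult_mono) auto
  then have z: "\<bar>s\<^sup>2 * p$3\<bar> \<le> s ^ 6"
    by (simp flip: power_add)
  have af: "0 \<le> a * f" "a * f \<le> s ^ 3 / 6" "0 \<le> b * g" "b * g \<le> s ^ 3 / 6"
    using ab fg \<open>s \<ge> 2\<close> mult_mono[of a "s ^ 3 / 6" f 1] mult_mono[of b "s ^ 3 / 6" g 1] by auto
  have sq: "0 \<le> a\<^sup>2" "a\<^sup>2 \<le> s ^ 6 / 36" "0 \<le> b\<^sup>2" "b\<^sup>2 \<le> s ^ 6 / 36"
    using ab power_mono[of a "s ^ 3 / 6" 2] power_mono[of b "s ^ 3 / 6" 2]
    by (auto simp: power_divide simp flip: power_mult)
  define F where "F = \<lfloor>s\<^sup>2 * p$3 - 6 * (a * f + b * g)\<rfloor>"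
  define H where "H = 9 * ((int i)\<^sup>2 + (int j)\<^sup>2)"
  have H: "real_of_int H = 9 * (a\<^sup>2 + b\<^sup>2)"
    by (simp add: H_def a_def b_def)
  have "F \<le> \<lceil>s ^ 6\<rceil>"
    using z af unfolding F_def distrib_left by linarith
  moreover have "real_of_int F \<ge> - (s ^ 6) - 2 * s ^ 3 - 1"
    using z af unfolding F_def distrib_left by linarith
  then have "real_of_int (F - H) \<ge> - 4 * s ^ 6"
    using H sq s36 s3 by simp
  then have "F - H \<ge> -4 * \<lceil>s ^ 6\<rceil>"
    by linarith
  moreover have "H \<ge> 0"
    by (simp add: H_def)
  ultimately have "F - H \<in> {-4 * \<lceil>s ^ 6\<rceil>..\<lceil>s ^ 6\<rceil>}"
    by simp
  then show ?thesis
    using horizontal[OF \<open>i < N\<close>, of 1] horizontal[OF \<open>j < N\<close>, of 2]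
    by (simp add: cap_shift_def F_def H_def a_def b_def f_def g_def)
qed

lemma card_cap_shift_range:
  assumes "s \<ge> 2"
  shows "real (card ({-3 * \<lceil>s ^ 3\<rceil>..\<lceil>s ^ 3\<rceil>} \<times> {-3 * \<lceil>s ^ 3\<rceil>..\<lceil>s ^ 3\<rceil>}
    \<times> {-4 * \<lceil>s ^ 6\<rceil>..\<lceil>s ^ 6\<rceil>})) \<le> 1200 * s ^ 12"
proof -
  have s: "8 \<le> s ^ 3" "64 \<le> s ^ 6"
    using power_mono[of 2 s 3] power_mono[of 2 s 6] assms by simp_all
  have c: "real (card {-3 * \<lceil>s ^ 3\<rceil>..\<lceil>s ^ 3\<rceil>}) \<le> 10 * s ^ 3"
    using s assms by (intro card_int_interval_le) (simp, linarith, simp)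
  have d: "real (card {-4 * \<lceil>s ^ 6\<rceil>..\<lceil>s ^ 6\<rceil>}) \<le> 12 * s ^ 6"
    using s assms by (intro card_int_interval_le) (simp, linarith, simp)
  have "real (card {-3 * \<lceil>s ^ 3\<rceil>..\<lceil>s ^ 3\<rceil>}) * (real (card {-3 * \<lceil>s ^ 3\<rceil>..\<lceil>s ^ 3\<rceil>})
      * real (card {-4 * \<lceil>s ^ 6\<rceil>..\<lceil>s ^ 6\<rceil>})) \<le> 10 * s ^ 3 * (10 * s ^ 3 * (12 * s ^ 6))"
    using assms by (intro mult_mono c d) auto
  also have "\<dots> = 1200 * s ^ 12"
    by (simp flip: power_add)
  finally show ?thesis
    by (simp only: card_cartesian_product of_nat_mult)
qed

section \<open>Averaging over caps and translations\<close>

text \<open>Double counting followed by pigeonhole. In use, \<open>S\<close> indexes the caps,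
  \<open>T\<close> holds the translations, and \<open>t\<close> is a translation that fills at least
  the average number of caps.\<close>

lemma ex_popular_value:
  fixes f :: "'s \<Rightarrow> 'a \<Rightarrow> 't"
  assumes "finite S" "finite T" "T \<noteq> {}" "\<And>\<sigma>. \<sigma> \<in> S \<Longrightarrow> f \<sigma> ` A \<subseteq> T"
  obtains t where "t \<in> T"
    "(\<Sum>\<sigma>\<in>S. real (card (f \<sigma> ` A))) \<le> real (card T) * real (card {\<sigma>\<in>S. t \<in> f \<sigma> ` A})"
proof -
  define g where "g t = real (card {\<sigma>\<in>S. t \<in> f \<sigma> ` A})" for t
  have "(\<Sum>\<sigma>\<in>S. real (card (f \<sigma> ` A))) = (\<Sum>\<sigma>\<in>S. \<Sum>t\<in>T. if t \<in> f \<sigma> ` A then 1 else 0)"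
  proof (rule sum.cong[OF refl])
    fix \<sigma> assume "\<sigma> \<in> S"
    then have "T \<inter> {t. t \<in> f \<sigma> ` A} = f \<sigma> ` A"
      using assms(4) by auto
    then show "real (card (f \<sigma> ` A)) = (\<Sum>t\<in>T. if t \<in> f \<sigma> ` A then 1 else 0)"
      using \<open>finite T\<close> by (simp add: sum.If_cases)
  qed
  also have "\<dots> = (\<Sum>t\<in>T. \<Sum>\<sigma>\<in>S. if t \<in> f \<sigma> ` A then 1 else 0)"
    by (rule sum.swap)
  also have "\<dots> = sum g T"
    using \<open>finite S\<close> by (simp add: g_def sum.If_cases Int_def)
  also have "\<dots> \<le> real (card T) * Max (g ` T)"
    using \<open>finite T\<close> by (intro sum_bounded_above) auto
  finally have le: "(\<Sum>\<sigma>\<in>S. real (card (f \<sigma> ` A))) \<le> real (card T) * Max (g ` T)" .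
  have "Max (g ` T) \<in> g ` T"
    using assms(2,3) by (intro Max_in) auto
  then obtain t where "t \<in> T" "Max (g ` T) = g t"
    by blast
  with le show thesis
    by (intro that) (auto simp: g_def)
qed

text \<open>Takes one point from each cap that \<open>t\<close> fills. The tangent plane at a cap
  separates its point from the others; strictness also makes the chosen points distinct, so no cap
  is lost in the count.\<close>

lemma ex_convex_position_of_common_shift:
  fixes A :: "(real ^ 3) set"
  assumes "s > 0" "finite S"
  obtains B where "B \<subseteq> A" "convex_position B" "card B = card {\<sigma>\<in>S. t \<in> cap_shift s \<sigma> ` A}"
proof -
  let ?S = "{\<sigma>\<in>S. t \<in> cap_shift s \<sigma> ` A}"
  have "\<forall>\<sigma>\<in>?S. \<exists>p. p \<in> A \<and> cap_shift s \<sigma> p = t"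
    by blast
  from bchoice[OF this]
  obtain P where P: "\<And>\<sigma>. \<sigma> \<in> ?S \<Longrightarrow> P \<sigma> \<in> A \<and> cap_shift s \<sigma> (P \<sigma>) = t"
    by blast
  \<comment> \<open>Upward normal of the tangent plane at \<open>(3i, 3j)\<close>, pulled back to
    the original coordinates.\<close>
  define c :: "nat \<times> nat \<Rightarrow> real ^ 3" where
    "c = (\<lambda>(i, j). vector [- 6 * real i / s, - 6 * real j / s, s\<^sup>2])"
  have less: "c \<sigma> \<bullet> P \<sigma> < c \<sigma> \<bullet> P \<tau>" if "\<sigma> \<in> ?S" "\<tau> \<in> ?S" "\<sigma> \<noteq> \<tau>" for \<sigma> \<tau>
  proof -
    obtain i j k l where ij: "\<sigma> = (i, j)" "\<tau> = (k, l)"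
      by (cases \<sigma>, cases \<tau>) blast
    have "cap_shift s (i, j) (P \<sigma>) = cap_shift s (k, l) (P \<tau>)"
      using P[OF that(1)] P[OF that(2)] ij by simp
    from cap_shift_separates[OF \<open>s > 0\<close> this] that(3) show ?thesis
      by (simp add: ij c_def inner_vec_def sum_3 algebra_simps)
  qed
  have inj: "inj_on P ?S"
  proof (rule inj_onI, rule ccontr)
    fix \<sigma> \<tau> assume "\<sigma> \<in> ?S" "\<tau> \<in> ?S" "P \<sigma> = P \<tau>" "\<sigma> \<noteq> \<tau>"
    with less[of \<sigma> \<tau>] show False by simp
  qed
  show thesis
  proof
    show "P ` ?S \<subseteq> A"
      using P by blast
    show "card (P ` ?S) = card ?S"
      using inj by (rule card_image)
    show "convex_position (P ` ?S)"
    proof (rule convex_position_if_strict_minimizers)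
      fix x assume "x \<in> P ` ?S"
      then obtain \<sigma> where \<sigma>: "\<sigma> \<in> ?S" "x = P \<sigma>" by blast
      have "\<forall>y\<in>P ` ?S - {x}. c \<sigma> \<bullet> x < c \<sigma> \<bullet> y"
        using less \<sigma> by blast
      then show "\<exists>c. \<forall>y\<in>P ` ?S - {x}. c \<bullet> x < c \<bullet> y" ..
    qed (use \<open>finite S\<close> in simp)
  qed
qed

text \<open>Each point takes part in O(N^2) collisions over all caps, so for a typical cap the
  points of \<open>A\<close> need a number of translations proportional to
  \<open>card A\<close>.\<close>

lemma sum_card_images_cap_shift_ge:
  fixes A :: "(real ^ 3) set"
  assumes "s \<ge> 2" "s ^ 3 / 12 \<le> real N" "real N \<le> s ^ 3 / 6" "finite A"
    and sep: "\<And>x y. x \<in> A \<Longrightarrow> y \<in> A \<Longrightarrow> x \<noteq> y \<Longrightarrow> dist x y \<ge> 1"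
  shows "real (card A) * (real N)\<^sup>2 / 70000
    \<le> (\<Sum>\<sigma>\<in>{..<N} \<times> {..<N}. real (card (cap_shift s \<sigma> ` A)))"
proof -
  let ?S = "{..<N} \<times> {..<N}"
  \<comment> \<open>Rounded up from \<open>1 + 5760 * 12 = 69121\<close>: the diagonal pairs plus
    the collision bound with \<open>s ^ 3 \<le> 12 * N\<close>.\<close>
  let ?k = "70000 :: real"
  have "(\<Sum>\<sigma>\<in>?S. \<Sum>p\<in>A. real (card {q\<in>A. cap_shift s \<sigma> q = cap_shift s \<sigma> p}))
    = (\<Sum>\<sigma>\<in>?S. \<Sum>p\<in>A. \<Sum>q\<in>A. if cap_shift s \<sigma> p = cap_shift s \<sigma> q then 1 else 0)"
    using \<open>finite A\<close> by (simp add: sum.If_cases Int_def eq_commute)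
  also have "\<dots> = (\<Sum>p\<in>A. \<Sum>\<sigma>\<in>?S. \<Sum>q\<in>A. if cap_shift s \<sigma> p = cap_shift s \<sigma> q then 1 else 0)"
    by (rule sum.swap)
  also have "\<dots> = (\<Sum>p\<in>A. \<Sum>q\<in>A. \<Sum>\<sigma>\<in>?S. if cap_shift s \<sigma> p = cap_shift s \<sigma> q then 1 else 0)"
    by (intro sum.cong sum.swap refl)
  also have "\<dots> = (\<Sum>p\<in>A. \<Sum>q\<in>A. real (card {\<sigma> \<in> ?S. cap_shift s \<sigma> p = cap_shift s \<sigma> q}))"
    by (simp add: sum.If_cases Int_def)
  also have "\<dots> \<le> (\<Sum>p\<in>A. ?k * (real N)\<^sup>2)"
  proof (rule sum_mono)
    fix p assume "p \<in> A"
    then have "(\<Sum>q\<in>A. real (card {\<sigma> \<in> ?S. cap_shift s \<sigma> p = cap_shift s \<sigma> q}))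
      = real (card ?S) + (\<Sum>q\<in>A - {p}. real (card {\<sigma> \<in> ?S. cap_shift s \<sigma> p = cap_shift s \<sigma> q}))"
      using \<open>finite A\<close> by (subst sum.remove[of A p]) auto
    also have "\<dots> \<le> (real N)\<^sup>2 + 5760 * real N * s ^ 3"
      using sum_collisions_le[OF \<open>s \<ge> 2\<close> assms(3,4) \<open>p \<in> A\<close> sep]
      by (simp add: card_cartesian_product power2_eq_square)
    also have "\<dots> \<le> (real N)\<^sup>2 + 5760 * real N * (12 * real N)"
      using assms(2) by (intro add_left_mono mult_left_mono) auto
    also have "\<dots> \<le> ?k * (real N)\<^sup>2"
      by (simp add: power2_eq_square)
    finally show "(\<Sum>q\<in>A. real (card {\<sigma> \<in> ?S. cap_shift s \<sigma> p = cap_shift s \<sigma> q})) \<le> ?k * (real N)\<^sup>2" .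
  qed
  finally have pairs: "(\<Sum>\<sigma>\<in>?S. \<Sum>p\<in>A. real (card {q\<in>A. cap_shift s \<sigma> q = cap_shift s \<sigma> p}))
    \<le> ?k * (real (card A) * (real N)\<^sup>2)"
    by simp
  \<comment> \<open>With \<open>k\<close> equal to the constant in \<open>pairs\<close>,
    \<open>2/k - k/k\<^sup>2 = 1/k\<close>.\<close>
  have "real (card A) * (real N)\<^sup>2 / ?k
    \<le> 2 * real (card A) * (real N)\<^sup>2 / ?k - ?k * (real (card A) * (real N)\<^sup>2) / ?k\<^sup>2"
    by (simp add: power2_eq_square)
  also have "\<dots> \<le> 2 * real (card A) * (real N)\<^sup>2 / ?k
    - (\<Sum>\<sigma>\<in>?S. \<Sum>p\<in>A. real (card {q\<in>A. cap_shift s \<sigma> q = cap_shift s \<sigma> p})) / ?k\<^sup>2"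
    using pairs by (intro diff_left_mono divide_right_mono) auto
  also have "\<dots> = (\<Sum>\<sigma>\<in>?S. 2 * real (card A) / ?k
    - (\<Sum>p\<in>A. real (card {q\<in>A. cap_shift s \<sigma> q = cap_shift s \<sigma> p})) / ?k\<^sup>2)"
    by (simp add: sum_subtractf sum_divide_distrib card_cartesian_product power2_eq_square)
  also have "\<dots> \<le> (\<Sum>\<sigma>\<in>?S. real (card (cap_shift s \<sigma> ` A)))"
    using \<open>finite A\<close> by (intro sum_mono card_fibres_le_card_image) auto
  finally show ?thesis .
qed

text \<open>At least order \<open>card A * s ^ 6\<close> incidences of caps and translations are
  spread over O(s^12) translations, so some translation fills at least order
  \<open>card A / s ^ 6\<close> caps.\<close>

lemma ex_convex_position_subset_separated:
  fixes A :: "(real ^ 3) set"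
  assumes "s \<ge> 2" "finite A" "\<And>p k. p \<in> A \<Longrightarrow> \<bar>p$k\<bar> \<le> s ^ 4"
    and sep: "\<And>x y. x \<in> A \<Longrightarrow> y \<in> A \<Longrightarrow> x \<noteq> y \<Longrightarrow> dist x y \<ge> 1"
  shows "\<exists>B\<subseteq>A. convex_position B \<and> real (card A) \<le> 12096000000 * s ^ 6 * real (card B)"
proof -
  \<comment> \<open>The largest \<open>N\<close> that keeps the slopes bounded by 1; as
    \<open>s ^ 3 / 6 > 1\<close>, rounding down loses less than a factor 2.\<close>
  define N where "N = nat \<lfloor>s ^ 3 / 6\<rfloor>"
  have s3: "8 \<le> s ^ 3"
    using power_mono[of 2 s 3] \<open>s \<ge> 2\<close> by simp
  have N: "s ^ 3 / 12 \<le> real N" "real N \<le> s ^ 3 / 6"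
  proof -
    have "1 \<le> \<lfloor>s ^ 3 / 6\<rfloor>"
      using s3 by (simp add: le_floor_iff)
    moreover from this have "real N = real_of_int \<lfloor>s ^ 3 / 6\<rfloor>"
      unfolding N_def by (intro of_nat_nat) linarith
    ultimately show "s ^ 3 / 12 \<le> real N" "real N \<le> s ^ 3 / 6"
      by linarith+
  qed
  let ?S = "{..<N} \<times> {..<N}"
  define T where "T = {-3 * \<lceil>s ^ 3\<rceil>..\<lceil>s ^ 3\<rceil>} \<times> {-3 * \<lceil>s ^ 3\<rceil>..\<lceil>s ^ 3\<rceil>}
    \<times> {-4 * \<lceil>s ^ 6\<rceil>..\<lceil>s ^ 6\<rceil>}"
  have s6: "0 < s ^ 6"
    using \<open>s \<ge> 2\<close> by simp
  have "finite T" "T \<noteq> {}"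
  proof -
    have "0 \<le> \<lceil>s ^ 3\<rceil>" "0 \<le> \<lceil>s ^ 6\<rceil>"
      using s3 s6 by linarith+
    then have "(0, 0, 0) \<in> T"
      unfolding T_def by auto
    then show "T \<noteq> {}" by blast
  qed (simp add: T_def)
  have sub: "cap_shift s \<sigma> ` A \<subseteq> T" if "\<sigma> \<in> ?S" for \<sigma>
    using that cap_shift_range[OF \<open>s \<ge> 2\<close> N(2) _ _ assms(3), folded T_def] by blast
  obtain t where t: "(\<Sum>\<sigma>\<in>?S. real (card (cap_shift s \<sigma> ` A)))
      \<le> real (card T) * real (card {\<sigma>\<in>?S. t \<in> cap_shift s \<sigma> ` A})"
    by (rule ex_popular_value[OF _ \<open>finite T\<close> \<open>T \<noteq> {}\<close> sub]) auto
  obtain B where B: "B \<subseteq> A" "convex_position B"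
      "card B = card {\<sigma>\<in>?S. t \<in> cap_shift s \<sigma> ` A}"
    using ex_convex_position_of_common_shift[of s ?S A t] \<open>s \<ge> 2\<close> by auto
  have "real (card A) * (s ^ 3 / 12)\<^sup>2 / 70000 \<le> real (card A) * (real N)\<^sup>2 / 70000"
    using N \<open>s \<ge> 2\<close> by (intro divide_right_mono mult_left_mono power_mono) auto
  also have "\<dots> \<le> (\<Sum>\<sigma>\<in>?S. real (card (cap_shift s \<sigma> ` A)))"
    by (rule sum_card_images_cap_shift_ge[OF \<open>s \<ge> 2\<close> N \<open>finite A\<close>]) (rule sep)
  also have "\<dots> \<le> real (card T) * real (card B)"
    using t B(3) by simp
  also have "\<dots> \<le> 1200 * s ^ 12 * real (card B)"
    using card_cap_shift_range[OF \<open>s \<ge> 2\<close>] unfolding T_def by (intro mult_right_mono) auto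
  finally have "real (card A) * (s ^ 3 / 12)\<^sup>2 / 70000 \<le> 1200 * s ^ 12 * real (card B)" .
  moreover have "(s ^ 3 / 12)\<^sup>2 = s ^ 6 / 144"
    by (simp add: power_divide flip: power_mult)
  \<comment> \<open>\<open>12096000000 = 144 * 70000 * 1200\<close>.\<close>
  ultimately have "s ^ 6 * real (card A) \<le> 12096000000 * s ^ 12 * real (card B)"
    by (simp add: mult.commute)
  also have "s ^ 12 = s ^ 6 * s ^ 6"
    by (simp flip: power_add)
  also have "12096000000 * (s ^ 6 * s ^ 6) * real (card B) = s ^ 6 * (12096000000 * s ^ 6 * real (card B))"
    by (simp only: mult_ac)
  finally have "s ^ 6 * real (card A) \<le> s ^ 6 * (12096000000 * s ^ 6 * real (card B))" .
  then have "real (card A) \<le> 12096000000 * s ^ 6 * real (card B)"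
    by (rule mult_left_le_imp_le[OF _ s6])
  with B show ?thesis by blast
qed

section \<open>From bounded spread to separated points, and the choice of constants\<close>

lemma ex_convex_position_subset_spread:
  fixes A :: "(real ^ 3) set"
  assumes "s \<ge> 2" "finite A" "card A \<ge> 2" "spread A \<le> s ^ 4"
  shows "\<exists>B\<subseteq>A. convex_position B \<and> real (card A) \<le> 12096000000 * s ^ 6 * real (card B)"
proof -
  let ?D = "pairwise_distances A"
  have fin: "finite ?D"
  proof (rule finite_subset)
    show "?D \<subseteq> (\<lambda>(x, y). dist x y) ` (A \<times> A)"
      by (auto simp: pairwise_distances_def)
  qed (use \<open>finite A\<close> in simp)
  obtain a b where ab: "a \<in> A" "b \<in> A" "a \<noteq> b"
    using \<open>card A \<ge> 2\<close> by (metis card_le_Suc0_iff_eq \<open>finite A\<close> not_less_eq_eq numeral_2_eq_2)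
  then have "?D \<noteq> {}"
    by (auto simp: pairwise_distances_def)
  define \<delta> where "\<delta> = Min ?D"
  have "\<delta> \<in> ?D"
    unfolding \<delta>_def using fin \<open>?D \<noteq> {}\<close> by (rule Min_in)
  then have "\<delta> > 0"
    by (auto simp: pairwise_distances_def)
  have lo: "\<delta> \<le> dist x y" if "x \<in> A" "y \<in> A" "x \<noteq> y" for x y
    unfolding \<delta>_def using that fin by (intro Min_le) (auto simp: pairwise_distances_def)
  have hi: "dist x y \<le> s ^ 4 * \<delta>" if "x \<in> A" "y \<in> A" for x y
  proof (cases "x = y")
    case False
    then have "dist x y \<le> Max ?D"
      using that fin by (intro Max_ge) (auto simp: pairwise_distances_def)
    also have "\<dots> \<le> s ^ 4 * \<delta>"
      using assms(4) \<open>\<delta> > 0\<close> by (simp add: spread_def \<delta>_def[symmetric] pos_divide_le_eq)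
    finally show ?thesis .
  qed (use \<open>s \<ge> 2\<close> \<open>\<delta> > 0\<close> in simp)
  \<comment> \<open>Scales the minimum distance to 1 and moves \<open>a\<close> to the origin, so
    that the scaled diameter, at most \<open>s ^ 4\<close>, bounds all coordinates.\<close>
  define g where "g x = - (a /\<^sub>R \<delta>) + (1 / \<delta>) *\<^sub>R x" for x :: "real ^ 3"
  have g_diff: "g x - g y = (1 / \<delta>) *\<^sub>R (x - y)" for x y
    by (simp add: g_def algebra_simps)
  have g_dist: "dist (g x) (g y) = dist x y / \<delta>" for x y
    using \<open>\<delta> > 0\<close> by (simp add: dist_norm g_diff)
  have inj: "inj g"
    using \<open>\<delta> > 0\<close> by (auto simp: inj_on_def g_def)
  have "g a = 0"
    by (simp add: g_def divide_inverse_commute)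
  have "\<exists>C\<subseteq>g ` A. convex_position C \<and> real (card (g ` A)) \<le> 12096000000 * s ^ 6 * real (card C)"
  proof (rule ex_convex_position_subset_separated[OF \<open>s \<ge> 2\<close>])
    fix p k assume "p \<in> g ` A"
    then obtain x where x: "x \<in> A" "p = g x" by blast
    have "\<bar>p$k\<bar> \<le> norm p"
      by (rule component_le_norm_cart)
    also have "\<dots> = dist x a / \<delta>"
      using g_dist[of x a] \<open>g a = 0\<close> x by simp
    also have "\<dots> \<le> s ^ 4"
      using hi[OF x(1) \<open>a \<in> A\<close>] \<open>\<delta> > 0\<close> by (simp add: pos_divide_le_eq)
    finally show "\<bar>p$k\<bar> \<le> s ^ 4" .
  next
    fix p q assume "p \<in> g ` A" "q \<in> g ` A" "p \<noteq> q"
    then show "1 \<le> dist p q"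
      using \<open>\<delta> > 0\<close> by (auto simp: g_dist intro!: lo)
  qed (use \<open>finite A\<close> in simp)
  then obtain B where B: "B \<subseteq> A" "convex_position (g ` B)"
      "real (card (g ` A)) \<le> 12096000000 * s ^ 6 * real (card (g ` B))"
    by (auto simp: subset_image_iff)
  have "convex_position B"
    by (rule convex_position_affinity[of "1 / \<delta>" "- (a /\<^sub>R \<delta>)"])
      (use B \<open>\<delta> > 0\<close> in \<open>auto simp: g_def[abs_def]\<close>)
  moreover have "card (g ` X) = card X" for X
    using inj by (intro card_image) (auto simp: inj_on_def)
  ultimately show ?thesis
    using B by auto
qed

theorem theorem4:
  fixes \<alpha> :: real
  assumes "\<alpha> > 0"
  shows "\<exists>\<beta>>0. \<forall>(A :: (real ^ 3) set) n.
           finite A \<and> card A = n \<and> n \<ge> 2 \<and> general_position A \<and>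
           spread A \<le> \<alpha> * real n powr (1 / 3) \<longrightarrow>
           (\<exists>B\<subseteq>A. real (card B) \<ge> \<beta> * real n powr (1 / 2) \<and> convex_position B)"
proof -
  \<comment> \<open>The first term serves \<open>s \<ge> 2\<close>; the second makes the required
    size at most 1 when \<open>s < 2\<close>, where a single point suffices.\<close>
  define \<beta> where "\<beta> = min (1 / (12096000000 * \<alpha> powr (3/2))) ((\<alpha> / 16) powr (3/2))"
  have "\<exists>B\<subseteq>A. real (card B) \<ge> \<beta> * real n powr (1 / 2) \<and> convex_position B"
    if A: "finite A" "card A = n" "n \<ge> 2" "spread A \<le> \<alpha> * real n powr (1 / 3)"
    for A :: "(real ^ 3) set" and n
  proof -
    \<comment> \<open>Makes \<open>s ^ 4\<close> the bound on the spread; then \<open>s ^ 6\<close>,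
      and with it \<open>n / s ^ 6\<close>, has order \<open>n powr (1/2)\<close>.\<close>
    define s where "s = (\<alpha> * real n powr (1/3)) powr (1/4)"
    have "s > 0"
      using assms A(3) by (simp add: s_def)
    have s4: "s ^ 4 = \<alpha> * real n powr (1/3)"
      using assms A(3) by (simp add: s_def powr_power)
    have s6: "s ^ 6 = \<alpha> powr (3/2) * real n powr (1/2)"
      using assms A(3) by (simp add: s_def powr_power powr_powr powr_mult power_mult_distrib)
    show ?thesis
    proof (cases "s \<ge> 2")
      case True
      then obtain B where B: "B \<subseteq> A" "convex_position B"
          "real n \<le> 12096000000 * s ^ 6 * real (card B)"
        using ex_convex_position_subset_spread[of s A] A s4 by auto
      define r where "r = real n powr (1/2)"
      have r: "r > 0" "real n = r * r"
        using A(3) by (simp_all add: r_def flip: powr_add)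
      have "r * r \<le> r * (12096000000 * \<alpha> powr (3/2) * real (card B))"
      proof -
        have "real n \<le> r * (12096000000 * \<alpha> powr (3/2) * real (card B))"
          using B(3) by (simp add: s6 r_def mult_ac)
        then show ?thesis
          by (simp only: r(2))
      qed
      then have "r \<le> 12096000000 * \<alpha> powr (3/2) * real (card B)"
        using r(1) by simp
      then have "1 / (12096000000 * \<alpha> powr (3/2)) * r \<le> real (card B)"
        using assms by (simp add: field_simps)
      moreover have "\<beta> * r \<le> 1 / (12096000000 * \<alpha> powr (3/2)) * r"
        using r(1) by (intro mult_right_mono) (auto simp: \<beta>_def)
      ultimately show ?thesis
        using B by (auto simp: r_def)
    next
      case False
      obtain a where "a \<in> A"
        using A by fastforce
      \<comment> \<open>\<open>(\<alpha> / 16) powr (3/2) * n powr (1/2)\<close> is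
        \<open>s ^ 6 / 2 ^ 6\<close>, as \<open>16 powr (3/2) = 2 ^ 6\<close>.\<close>
      have "s ^ 6 \<le> 2 ^ 6"
        using False \<open>s > 0\<close> by (intro power_mono) auto
      also have "\<dots> = (16 :: real) powr (3/2)"
      proof -
        have "(16 :: real) powr (3/2) = (4 powr 2) powr (3/2)" by simp
        also have "\<dots> = 4 powr 3" by (simp only: powr_powr) simp
        finally show ?thesis by simp
      qed
      finally have "(\<alpha> / 16) powr (3/2) * real n powr (1/2) \<le> 1"
        using assms by (simp add: s6 powr_divide)
      moreover have "\<beta> * real n powr (1/2) \<le> (\<alpha> / 16) powr (3/2) * real n powr (1/2)"
        by (intro mult_right_mono) (auto simp: \<beta>_def)
      ultimately have "\<beta> * real n powr (1/2) \<le> real (card {a})"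
        by simp
      then show ?thesis
        using \<open>a \<in> A\<close> by (intro exI[of _ "{a}"]) simp
    qed
  qed
  moreover have "\<beta> > 0"
    using assms by (simp add: \<beta>_def)
  ultimately show ?thesis
    by blast
qed

end
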